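(* Let $C$ and $Q$ be nonempty, closed and convex subsets of finite-dimensional real Banach spaces $E_1$ and $E_2$, respectively, let $A:E_1\to E_2$ be a bounded linear operator, and let $f:E_1\times E_1\to\mathbb{R}$ and $g:E_2\times E_2\to\mathbb{R}$ be bifunctions. Let $N$ be a normed space of parameters and let $M\subset N$ be a closed ball centered at $p^*\in M$ with positive radius. Let $\tilde f:M\times E_1\times E_1\to\mathbb{R}$ and $\tilde g:M\times E_2\times E_2\to\mathbb{R}$ be functions with $\tilde f(p^*,\cdot,\cdot)=f$ and $\tilde g(p^*,\cdot,\cdot)=g$ which satisfy the following conditions: (i) $\tilde f(p^*,\cdot,\cdot)$ and $\tilde g(p^*,\cdot,\cdot)$ are hemicontinuous. (ii) $\tilde f(p,\cdot,\cdot)$ and $\tilde g(p,\cdot,\cdot)$ are both monotone for all $p\in M$. (iii) $\tilde f(p,x,\cdot)$ and $\tilde g(p,y,\cdot)$ are both convex for all $p\in M$ and $(x,y)\in E_1\times E_2$. (iv) $\tilde f(p^*,x,x)$ and $\tilde g(p^*,y,y)$ are nonnegative for every $(x,y)\in C\times Q$. (v) $\tilde f(\cdot,x,\cdot)$ and $\tilde g(\cdot,y,\cdot)$ are both continuous for all $(x,y)\in E_1\times E_2$. Then the split equilibrium problem $SEP(f,g,C,Q)$ is Levitin-Polyak (LP) well-posed by perturbations if and only if $SEP(f,g,C,Q)$ has a unique solution.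
   Context: The split equilibrium problem $SEP(f,g,C,Q)$ is: find $(x^*,y^* )\in E_1\times E_2$ such that $x^*\in C$, $y^*\in Q$, $y^*=Ax^*$, $f(x^*,x)\ge 0$ for all $x\in C$, and $g(y^*,y)\ge 0$ for all $y\in Q$. Its solution set is denoted by $S$. The space $E_1\times E_2$ carries a standard product norm (e.g. $\|(x,y)\|=\|x\|+\|y\|$). A bifunction $h:K\times K\to\mathbb{R}$ on a nonempty subset $K$ of a real Banach space is monotone if $h(x,y)+h(y,x)\le 0$ for all $x,y\in K$. If $K$ is convex, $h$ is hemicontinuous if $\limsup_{t\to 0^+}h(x+t(y-x),y)\le h(x,y)$ for all $x,y\in K$. In conditions (i) and (ii) these notions are applied with $K=E_1$ for $\tilde f$ and $K=E_2$ for $\tilde g$. In condition (v), continuity is joint continuity in the two free variables. Generalized approximating sequence: let $\{p_n\}\subset M$ with $p_n\to p^*$. A sequence $\{(x_n,y_n)\}$ in $E_1\times E_2$ is a generalized approximating sequence corresponding to $\{p_n\}$ for $SEP(f,g,C,Q)$ if there exists a sequence of positive numbers $\epsilon_n\to 0$ such that, for every $n$, $d(x_n,C)\le\epsilon_n$, $d(y_n,Q)\le\epsilon_n$, $\|y_n-Ax_n\|\le\epsilon_n$, $\tilde f(p_n,x_n,x)\ge-\epsilon_n$ for all $x\in C$, and $\tilde g(p_n,y_n,y)\ge-\epsilon_n$ for all $y\in Q$. Here $d(a,B)=\inf_{b\in B}\|a-b\|$. LP (Levitin-Polyak) well-posedness by perturbations: $SEP(f,g,C,Q)$ is LP well-posed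 by perturbations if $S$ is a singleton and, for any $\{p_n\}\subset M$ with $p_n\to p^*$, every generalized approximating sequence corresponding to $\{p_n\}$ converges to the unique solution. *)

theory Defs
  imports "HOL-Analysis.Analysis"
begin

definition monotone_bifun :: "'a set \<Rightarrow> ('a \<Rightarrow> 'a \<Rightarrow> real) \<Rightarrow> bool" where
  "monotone_bifun K h \<longleftrightarrow> (\<forall>x\<in>K. \<forall>y\<in>K. h x y + h y x \<le> 0)"

(* The limit superior is taken in the extended reals, since it may be infinite a priori. *)
definition hemicontinuous_bifun :: "'a::real_normed_vector set \<Rightarrow> ('a \<Rightarrow> 'a \<Rightarrow> real) \<Rightarrow> bool" where
  "hemicontinuous_bifun K h \<longleftrightarrow>
     (\<forall>x\<in>K. \<forall>y\<in>K.
        Limsup (at_right (0::real)) (\<lambda>t. ereal (h (x + t *\<^sub>R (y - x)) y)) \<le> ereal (h x y))"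

definition SEP_solutions ::
  "('a \<Rightarrow> 'a \<Rightarrow> real) \<Rightarrow> ('b \<Rightarrow> 'b \<Rightarrow> real) \<Rightarrow> 'a set \<Rightarrow> 'b set \<Rightarrow> ('a \<Rightarrow> 'b) \<Rightarrow> ('a \<times> 'b) set" where
  "SEP_solutions f g C Q A =
     {(x', y'). x' \<in> C \<and> y' \<in> Q \<and> y' = A x' \<and>
        (\<forall>x\<in>C. f x' x \<ge> 0) \<and> (\<forall>y\<in>Q. g y' y \<ge> 0)}"

(* For nonempty B, infdist a B is the infimum of norm (a - b) over b in B. *)
definition gen_approximating_seq ::
  "('n \<Rightarrow> 'a \<Rightarrow> 'a \<Rightarrow> real) \<Rightarrow> ('n \<Rightarrow> 'b \<Rightarrow> 'b \<Rightarrow> real) \<Rightarrow>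
   'a::real_normed_vector set \<Rightarrow> 'b::real_normed_vector set \<Rightarrow> ('a \<Rightarrow> 'b) \<Rightarrow>
   (nat \<Rightarrow> 'n) \<Rightarrow> (nat \<Rightarrow> 'a \<times> 'b) \<Rightarrow> bool" where
  "gen_approximating_seq ft gt C Q A p z \<longleftrightarrow>
     (\<exists>\<epsilon>::nat \<Rightarrow> real. (\<forall>n. \<epsilon> n > 0) \<and> \<epsilon> \<longlonglongrightarrow> 0 \<and>
        (\<forall>n. infdist (fst (z n)) C \<le> \<epsilon> n \<and>
             infdist (snd (z n)) Q \<le> \<epsilon> n \<and>
             norm (snd (z n) - A (fst (z n))) \<le> \<epsilon> n \<and>
             (\<forall>x\<in>C. ft (p n) (fst (z n)) x \<ge> - \<epsilon> n) \<and>
             (\<forall>y\<in>Q. gt (p n) (snd (z n)) y \<ge> - \<epsilon> n)))"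

(* Perturbed bifunctions are total in the parameter; only their values for parameters in M matter.
   The library's product norm is the Euclidean one, equivalent to the sum norm. *)
definition LP_well_posed_by_perturbations ::
  "('a \<Rightarrow> 'a \<Rightarrow> real) \<Rightarrow> ('b \<Rightarrow> 'b \<Rightarrow> real) \<Rightarrow>
   'a::real_normed_vector set \<Rightarrow> 'b::real_normed_vector set \<Rightarrow> ('a \<Rightarrow> 'b) \<Rightarrow>
   'n::real_normed_vector set \<Rightarrow> 'n \<Rightarrow>
   ('n \<Rightarrow> 'a \<Rightarrow> 'a \<Rightarrow> real) \<Rightarrow> ('n \<Rightarrow> 'b \<Rightarrow> 'b \<Rightarrow> real) \<Rightarrow> bool" where
  "LP_well_posed_by_perturbations f g C Q A M pstar ft gt \<longleftrightarrow>
     (\<exists>s. SEP_solutions f g C Q A = {s} \<and>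
        (\<forall>p. (\<forall>n. p n \<in> M) \<and> p \<longlonglongrightarrow> pstar \<longrightarrow>
           (\<forall>z. gen_approximating_seq ft gt C Q A p z \<longrightarrow> z \<longlonglongrightarrow> s)))"

end

theory Submission
  imports Defs
begin

text \<open>
  Let \<open>s\<close> be the unique solution and suppose that an approximating sequence \<open>z\<close> stays at distance at
  least \<open>\<delta>\<close> from \<open>s\<close> along a subsequence. Pull its terms back along the segments towards \<open>s\<close> onto the
  sphere of radius \<open>\<delta>\<close> about \<open>s\<close>; by compactness these points accumulate at some \<open>w\<close> on that sphere.
  Monotonicity turns the approximate inequalities into upper bounds for \<open>ft (p n) x (z n)\<close>, which
  convexity in the last variable transfers to the pulled back points and joint continuity to \<open>w\<close>.
  Minty's lemma then shows that \<open>w\<close> is a second solution. The rescaling makes a separate proof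
  that \<open>z\<close> is bounded unnecessary.
\<close>

text \<open>Heine-Borel by induction on the spanning set. If \<open>b\<close> lies outside
  \<open>span B\<close>, it has positive distance \<open>d\<close> from that subspace. This bounds
  the coefficient \<open>a\<close> in \<open>v = a *\<^sub>R b + u\<close>, and with it
  \<open>u\<close>, so the ball is covered by a continuous image of a compact product.\<close>

lemma compact_cball_Int_span:
  fixes B :: "'a::real_normed_vector set"
  assumes "finite B"
  shows "compact (cball 0 R \<inter> span B)"
  using assms
proof (induction B arbitrary: R rule: finite_induct)
  case empty
  have "finite (cball 0 R \<inter> span ({}::'a set))"
    by simp
  then show ?case
    by (rule finite_imp_compact)
next
  case (insert b B)
  show ?case
  proof (cases "b \<in> span B")
    case True
    then show ?thesis
      using insert.IH by (simp add: span_redundant)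
  next
    case False
    \<comment> \<open>Vectors of norm above \<open>norm b + 1\<close> are at distance more than 1
      from \<open>b\<close>. It is therefore enough to separate \<open>b\<close> from this bounded
      piece of \<open>span B\<close>, which is closed by the induction hypothesis; hence the minimum
      with 1 in \<open>d\<close>.\<close>
    let ?K = "cball 0 (norm b + 1) \<inter> span B"
    have "closed ?K"
      using insert.IH compact_imp_closed by blast
    then have "open (- ?K)"
      by (rule open_Compl)
    moreover have "b \<in> - ?K"
      using False by simp
    ultimately obtain e where e: "e > 0" "ball b e \<subseteq> - ?K"
      by (rule openE)
    define d where "d = min e 1"
    have d: "d > 0"
      using e by (simp add: d_def)
    have far: "d \<le> norm (b - u)" if "u \<in> span B" for u
    proof (cases "norm u \<le> norm b + 1")
      case True
      with that have "u \<notin> ball b e"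
        using e(2) by auto
      then show ?thesis
        by (simp add: d_def dist_norm)
    next
      case False
      then show ?thesis
        using norm_triangle_ineq2[of u b] by (simp add: d_def norm_minus_commute)
    qed
    define R' where "R' = R + R / d * norm b"
    let ?P = "{- (R / d)..R / d} \<times> (cball 0 R' \<inter> span B)"
    let ?F = "\<lambda>(a, u). a *\<^sub>R b + u"
    have "compact (?F ` ?P)"
      unfolding case_prod_unfold
      by (intro compact_continuous_image continuous_intros compact_Times compact_Icc insert.IH)
    moreover have "cball 0 R \<inter> span (insert b B) = cball 0 R \<inter> ?F ` ?P"
    proof (intro equalityI subsetI)
      fix v assume v: "v \<in> cball 0 R \<inter> span (insert b B)"
      then obtain a where a: "v - a *\<^sub>R b \<in> span B"
        by (auto simp: span_insert)
      \<comment> \<open>Dividing by \<open>a\<close> writes \<open>v / a\<close> as \<open>b\<close>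
        minus an element of \<open>span B\<close>, so its norm is at least \<open>d\<close>.\<close>
      have "\<bar>a\<bar> * d \<le> norm v"
      proof (cases "a = 0")
        case False
        have "d \<le> norm (b - (- (1 / a)) *\<^sub>R (v - a *\<^sub>R b))"
          using a by (intro far span_scale)
        also have "b - (- (1 / a)) *\<^sub>R (v - a *\<^sub>R b) = (1 / a) *\<^sub>R v"
          using False by (simp add: algebra_simps)
        finally show ?thesis
          using False by (simp add: field_simps)
      qed simp
      with v have "\<bar>a\<bar> * d \<le> R"
        by simp
      then have abs_a: "\<bar>a\<bar> \<le> R / d"
        using d by (simp add: field_simps)
      have "norm (v - a *\<^sub>R b) \<le> norm v + \<bar>a\<bar> * norm b"
        using norm_triangle_ineq4[of v "a *\<^sub>R b"] by simp
      also have "\<dots> \<le> R'"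
        using v mult_right_mono[OF abs_a norm_ge_zero, of b] by (simp add: R'_def)
      finally have "(a, v - a *\<^sub>R b) \<in> ?P"
        using a abs_a by auto
      then have "?F (a, v - a *\<^sub>R b) \<in> ?F ` ?P"
        by (rule imageI)
      then show "v \<in> cball 0 R \<inter> ?F ` ?P"
        using v by simp
    next
      fix v assume "v \<in> cball 0 R \<inter> ?F ` ?P"
      then obtain a u where "v \<in> cball 0 R" "u \<in> span B" "v = a *\<^sub>R b + u"
        by auto
      then show "v \<in> cball 0 R \<inter> span (insert b B)"
        by (auto simp: span_insert intro!: exI[of _ a])
    qed
    ultimately show ?thesis
      by (simp add: closed_Int_compact)
  qed
qed

lemma compact_cball_finite_span:
  fixes x :: "'a::real_normed_vector"
  assumes "\<exists>B::'a set. finite B \<and> span B = UNIV"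
  shows "compact (cball x R)"
proof -
  obtain B :: "'a set" where "finite B" "span B = UNIV"
    using assms by blast
  then have "compact (cball (0::'a) R)"
    using compact_cball_Int_span[of B R] by simp
  then have "compact ((+) x ` cball 0 R)"
    by (rule compact_translation)
  then show ?thesis
    by (simp add: cball_translation)
qed

text \<open>At a point \<open>u\<close> of the segment from \<open>w\<close> to \<open>x\<close>,
  convexity bounds \<open>h u u\<close>, which is nonnegative, by a combination of
  \<open>h u w\<close> and \<open>h u x\<close>. The first of these is nonpositive by
  \<open>dual\<close>, so the second is nonnegative. Hemicontinuity preserves this as
  \<open>u\<close> tends to \<open>w\<close>.\<close>

lemma Minty_equilibrium:
  fixes C :: "'a::real_normed_vector set"
  assumes hemi: "hemicontinuous_bifun UNIV h"
    and conv: "\<And>x. convex_on UNIV (h x)"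
    and nonneg: "\<And>x. x \<in> C \<Longrightarrow> h x x \<ge> 0"
    and C: "convex C" "w \<in> C" "x \<in> C"
    and dual: "\<And>x. x \<in> C \<Longrightarrow> h x w \<le> 0"
  shows "h w x \<ge> 0"
proof -
  have seg: "h (w + t *\<^sub>R (x - w)) x \<ge> 0" if t: "0 < t" "t < 1" for t
  proof -
    let ?u = "w + t *\<^sub>R (x - w)"
    have u: "?u = (1 - t) *\<^sub>R w + t *\<^sub>R x"
      by (simp add: algebra_simps)
    have uC: "?u \<in> C"
      unfolding u using C t by (intro convexD) auto
    have "0 \<le> h ?u ?u"
      using nonneg uC .
    also have "\<dots> \<le> (1 - t) * h ?u w + t * h ?u x"
      using convex_onD[OF conv[of ?u], of t w x] t u by simp
    also have "\<dots> \<le> t * h ?u x"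
      using dual[OF uC] t by (simp add: mult_nonneg_nonpos)
    finally show ?thesis
      using t by (simp add: zero_le_mult_iff)
  qed
  have "\<forall>\<^sub>F t in at_right (0::real). ereal 0 \<le> ereal (h (w + t *\<^sub>R (x - w)) x)"
    using eventually_at_right_real[of 0 1] by (rule eventually_mono) (auto intro: seg)
  then have "ereal 0 \<le> Limsup (at_right (0::real)) (\<lambda>t. ereal (h (w + t *\<^sub>R (x - w)) x))"
    by (intro le_Limsup) auto
  also have "\<dots> \<le> ereal (h w x)"
    using hemi by (simp add: hemicontinuous_bifun_def)
  finally show ?thesis
    by simp
qed

text \<open>The points \<open>x n\<close> are only close to \<open>C\<close>, so they are replaced
  by nearby points \<open>c n\<close> of \<open>C\<close>. As \<open>t n\<close> is at most 1,
  rescaling does not enlarge the error, and the limit \<open>w\<close> is unchanged. The new points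
  are convex combinations of elements of \<open>C\<close>.\<close>

lemma limit_of_rescaled_in_closed_convex:
  fixes C :: "'a::real_normed_vector set"
  assumes C: "closed C" "convex C" "s \<in> C"
    and t: "\<And>n. 0 \<le> t n" "\<And>n. t n \<le> 1"
    and lim: "(\<lambda>n. s + t n *\<^sub>R (x n - s)) \<longlonglongrightarrow> w"
    and \<epsilon>: "\<And>n. \<epsilon> n > 0" "\<epsilon> \<longlonglongrightarrow> 0"
    and near: "\<And>n. infdist (x n) C \<le> \<epsilon> n"
  shows "w \<in> C"
proof -
  \<comment> \<open>The infimum need not be attained in this generality; the factor 2 leaves room
    for a strict inequality.\<close>
  have "\<exists>c\<in>C. dist (x n) c < 2 * \<epsilon> n" for n
  proof -
    have "infdist (x n) C < 2 * \<epsilon> n"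
      using near[of n] \<epsilon>(1)[of n] by simp
    moreover have "C \<noteq> {}"
      using C by auto
    ultimately show ?thesis
      using infdist_notempty[of C "x n"] cInf_lessD[of "dist (x n) ` C"] by auto
  qed
  then obtain c where c: "\<And>n. c n \<in> C" "\<And>n. dist (x n) (c n) < 2 * \<epsilon> n"
    by metis
  have "(\<lambda>n. t n *\<^sub>R (c n - x n)) \<longlonglongrightarrow> 0"
  proof (rule Lim_null_comparison)
    have "norm (t n *\<^sub>R (c n - x n)) \<le> 2 * \<epsilon> n" for n
    proof -
      have "t n * norm (c n - x n) \<le> 1 * norm (c n - x n)"
        using t by (intro mult_right_mono) auto
      then show ?thesis
        using t(1)[of n] c(2)[of n] by (simp add: dist_norm norm_minus_commute)
    qed
    then show "\<forall>\<^sub>F n in sequentially. norm (t n *\<^sub>R (c n - x n)) \<le> 2 * \<epsilon> n"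
      by simp
    show "(\<lambda>n. 2 * \<epsilon> n) \<longlonglongrightarrow> 0"
      using tendsto_mult_left[OF \<epsilon>(2), of 2] by simp
  qed
  from tendsto_add[OF lim this] have lim': "(\<lambda>n. (1 - t n) *\<^sub>R s + t n *\<^sub>R c n) \<longlonglongrightarrow> w"
    by (simp add: algebra_simps)
  have "(1 - t n) *\<^sub>R s + t n *\<^sub>R c n \<in> C" for n
    using C c t by (intro convexD) auto
  then show ?thesis
    using closed_sequentially[OF C(1) _ lim'] by simp
qed

text \<open>Stated for a single bifunction so that it applies to both components; these are coupled
  only through \<open>A\<close>.\<close>

lemma limit_of_rescaled_is_equilibrium:
  fixes C :: "'a::real_normed_vector set" and M :: "'n::real_normed_vector set"
  assumes C: "closed C" "convex C"
    and pstar: "pstar \<in> M"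
    and hemi: "hemicontinuous_bifun UNIV (h pstar)"
    and mono: "\<And>p. p \<in> M \<Longrightarrow> monotone_bifun UNIV (h p)"
    and conv: "\<And>p x. p \<in> M \<Longrightarrow> convex_on UNIV (h p x)"
    and nonneg: "\<And>x. x \<in> C \<Longrightarrow> h pstar x x \<ge> 0"
    and cont: "\<And>x. continuous_on (M \<times> UNIV) (\<lambda>(p, x'). h p x x')"
    and s: "s \<in> C" "\<And>x. x \<in> C \<Longrightarrow> h pstar s x \<ge> 0"
    and p: "\<And>n. p n \<in> M" "p \<longlonglongrightarrow> pstar"
    and t: "\<And>n. 0 \<le> t n" "\<And>n. t n \<le> 1"
    and lim: "(\<lambda>n. s + t n *\<^sub>R (x n - s)) \<longlonglongrightarrow> w"
    and \<epsilon>: "\<And>n. \<epsilon> n > 0" "\<epsilon> \<longlonglongrightarrow> 0"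
    and near: "\<And>n. infdist (x n) C \<le> \<epsilon> n"
    and approx: "\<And>n v. v \<in> C \<Longrightarrow> h (p n) (x n) v \<ge> - \<epsilon> n"
  shows "w \<in> C" and "\<And>v. v \<in> C \<Longrightarrow> h pstar w v \<ge> 0"
proof -
  show wC: "w \<in> C"
    by (rule limit_of_rescaled_in_closed_convex[where C = C and s = s and t = t and x = x and \<epsilon> = \<epsilon>])
      fact+
  \<comment> \<open>Continuity is available in the parameter and the last variable only. This is why
    the estimates below keep \<open>v\<close> in the middle and the moving point last.\<close>
  have cont_seq: "(\<lambda>n. h (p n) v (y n)) \<longlonglongrightarrow> h pstar v l" if "y \<longlonglongrightarrow> l" for v y l
    using continuous_on_tendsto_compose[OF cont[of v], of "\<lambda>n. (p n, y n)" "(pstar, l)" sequentially]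
      tendsto_Pair[OF p(2) that] p(1) pstar
    by simp
  have dual: "h pstar v w \<le> 0" if v: "v \<in> C" for v
  proof -
    let ?w = "\<lambda>n. s + t n *\<^sub>R (x n - s)"
    \<comment> \<open>Away from \<open>pstar\<close> the value \<open>h (p n) v s\<close> may be
      positive. The maximum with 0 absorbs the factor \<open>1 - t n\<close>, whose convergence is
      unknown, and it vanishes in the limit because \<open>h pstar v s\<close> is
      nonpositive.\<close>
    have "h (p n) v (?w n) \<le> max (h (p n) v s) 0 + \<epsilon> n" for n
    proof -
      have "?w n = (1 - t n) *\<^sub>R s + t n *\<^sub>R x n"
        by (simp add: algebra_simps)
      then have "h (p n) v (?w n) \<le> (1 - t n) * h (p n) v s + t n * h (p n) v (x n)"
        using convex_onD[OF conv[OF p(1)], of "t n" s "x n" n v] t by simp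
      also have "\<dots> \<le> 1 * max (h (p n) v s) 0 + 1 * \<epsilon> n"
      proof (rule add_mono)
        have "(1 - t n) * h (p n) v s \<le> (1 - t n) * max (h (p n) v s) 0"
          using t by (intro mult_left_mono) auto
        also have "\<dots> \<le> 1 * max (h (p n) v s) 0"
          using t by (intro mult_right_mono) auto
        finally show "(1 - t n) * h (p n) v s \<le> 1 * max (h (p n) v s) 0" .
        have "h (p n) v (x n) + h (p n) (x n) v \<le> 0"
          using mono[OF p(1)] by (auto simp: monotone_bifun_def)
        with approx[OF v, of n] have "h (p n) v (x n) \<le> \<epsilon> n"
          by simp
        then have "t n * h (p n) v (x n) \<le> t n * \<epsilon> n"
          using t by (intro mult_left_mono) auto
        also have "\<dots> \<le> 1 * \<epsilon> n"
          using t \<epsilon>(1)[of n] by (intro mult_right_mono) auto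
        finally show "t n * h (p n) v (x n) \<le> 1 * \<epsilon> n" .
      qed
      finally show ?thesis
        by simp
    qed
    moreover have "(\<lambda>n. h (p n) v (?w n)) \<longlonglongrightarrow> h pstar v w"
      by (rule cont_seq[OF lim])
    moreover have "(\<lambda>n. max (h (p n) v s) 0 + \<epsilon> n) \<longlonglongrightarrow> max (h pstar v s) 0 + 0"
      by (intro tendsto_intros cont_seq \<epsilon>(2))
    ultimately have "h pstar v w \<le> max (h pstar v s) 0 + 0"
      by (intro LIMSEQ_le) auto
    moreover have "h pstar v s + h pstar s v \<le> 0"
      using mono[OF pstar] by (auto simp: monotone_bifun_def)
    with s(2)[OF v] have "h pstar v s \<le> 0"
      by simp
    ultimately show ?thesis
      by simp
  qed
  show "h pstar w v \<ge> 0" if "v \<in> C" for v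
    by (rule Minty_equilibrium[where h = "h pstar" and C = C])
      (fact hemi conv[OF pstar] nonneg C(2) wC that dual)+
qed

lemma not_tendsto_subseq:
  fixes z :: "nat \<Rightarrow> 'a::metric_space"
  assumes "\<not> z \<longlonglongrightarrow> s"
  obtains \<delta> k where "\<delta> > 0" "strict_mono (k :: nat \<Rightarrow> nat)" "\<And>n. dist (z (k n)) s \<ge> \<delta>"
proof -
  obtain \<delta> where \<delta>: "\<delta> > 0" "\<not> (\<forall>\<^sub>F n in sequentially. dist (z n) s < \<delta>)"
    using assms by (auto simp: tendsto_iff)
  \<comment> \<open>Not being eventually close means being far frequently, and for natural indices
    that means infinitely often.\<close>
  then have "infinite {n. dist (z n) s \<ge> \<delta>}"
    unfolding frequently_cofinite[symmetric] cofinite_eq_sequentially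
    by (simp add: frequently_def not_le)
  then obtain k where "strict_mono (k :: nat \<Rightarrow> nat)" "\<forall>n. k n \<in> {n. dist (z n) s \<ge> \<delta>}"
    using infinite_enumerate by blast
  with \<delta>(1) show ?thesis
    by (intro that[of \<delta> k]) auto
qed

theorem theorem8:
  fixes C :: "'a::banach set" and Q :: "'b::banach set"
    and A :: "'a \<Rightarrow> 'b"
    and f :: "'a \<Rightarrow> 'a \<Rightarrow> real" and g :: "'b \<Rightarrow> 'b \<Rightarrow> real"
    and M :: "'n::real_normed_vector set" and pstar :: 'n and r :: real
    and ft :: "'n \<Rightarrow> 'a \<Rightarrow> 'a \<Rightarrow> real" and gt :: "'n \<Rightarrow> 'b \<Rightarrow> 'b \<Rightarrow> real"
  assumes fin_dim_E1: "\<exists>B::'a set. finite B \<and> span B = UNIV"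
    and fin_dim_E2: "\<exists>B::'b set. finite B \<and> span B = UNIV"
    and C: "C \<noteq> {}" "closed C" "convex C"
    and Q: "Q \<noteq> {}" "closed Q" "convex Q"
    and A: "bounded_linear A"
    and M: "r > 0" "M = cball pstar r"
    and ft_pstar: "\<And>x x'. ft pstar x x' = f x x'"
    and gt_pstar: "\<And>y y'. gt pstar y y' = g y y'"
    and hemicontinuous: "hemicontinuous_bifun UNIV (ft pstar)" "hemicontinuous_bifun UNIV (gt pstar)"
    and monotone: "\<And>p. p \<in> M \<Longrightarrow> monotone_bifun UNIV (ft p)"
      "\<And>p. p \<in> M \<Longrightarrow> monotone_bifun UNIV (gt p)"
    and convex: "\<And>p x. p \<in> M \<Longrightarrow> convex_on UNIV (ft p x)"
      "\<And>p y. p \<in> M \<Longrightarrow> convex_on UNIV (gt p y)"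
    and nonneg: "\<And>x. x \<in> C \<Longrightarrow> ft pstar x x \<ge> 0" "\<And>y. y \<in> Q \<Longrightarrow> gt pstar y y \<ge> 0"
    and continuous: "\<And>x. continuous_on (M \<times> UNIV) (\<lambda>(p, x'). ft p x x')"
      "\<And>y. continuous_on (M \<times> UNIV) (\<lambda>(p, y'). gt p y y')"
  shows "LP_well_posed_by_perturbations f g C Q A M pstar ft gt \<longleftrightarrow>
    (\<exists>!s. s \<in> SEP_solutions f g C Q A)"
proof
  assume "LP_well_posed_by_perturbations f g C Q A M pstar ft gt"
  then show "\<exists>!s. s \<in> SEP_solutions f g C Q A"
    by (auto simp: LP_well_posed_by_perturbations_def)
next
  assume ex1: "\<exists>!s. s \<in> SEP_solutions f g C Q A"
  then obtain xs ys where sol: "(xs, ys) \<in> SEP_solutions f g C Q A"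
    by auto
  then have S: "SEP_solutions f g C Q A = {(xs, ys)}"
    using ex1 by blast
  have xs: "xs \<in> C" "\<And>x. x \<in> C \<Longrightarrow> ft pstar xs x \<ge> 0"
    and ys: "ys \<in> Q" "\<And>y. y \<in> Q \<Longrightarrow> gt pstar ys y \<ge> 0" and ys_eq: "ys = A xs"
    using sol by (auto simp: SEP_solutions_def ft_pstar gt_pstar)
  have pstar: "pstar \<in> M"
    using M by simp
  interpret A: bounded_linear A
    by (fact A)
  have "z \<longlonglongrightarrow> (xs, ys)"
    if pM: "\<And>n. p n \<in> M" and p: "p \<longlonglongrightarrow> pstar" and z: "gen_approximating_seq ft gt C Q A p z"
    for p z
  proof (rule ccontr)
    let ?s = "(xs, ys)"
    assume "\<not> z \<longlonglongrightarrow> ?s"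
    then obtain \<delta> k where \<delta>: "\<delta> > 0" and k: "strict_mono (k :: nat \<Rightarrow> nat)"
      and far: "\<And>n. dist (z (k n)) ?s \<ge> \<delta>"
      using not_tendsto_subseq by metis
    \<comment> \<open>This factor puts \<open>w n\<close> on the sphere of radius
      \<open>\<delta>\<close> whenever \<open>z n\<close> differs from the solution. It is at most 1
      at the indices \<open>k n\<close>, the only ones used; elsewhere it may exceed 1, or be 0 by
      the convention for division by zero.\<close>
    define t where "t n = \<delta> / dist (z n) ?s" for n
    define w where "w n = ?s + t n *\<^sub>R (z n - ?s)" for n
    have w_dist: "dist (w (k n)) ?s = \<delta>" for n
    proof -
      have "dist (z (k n)) ?s > 0"
        using far[of n] \<delta> by linarith
      then show ?thesis
        using \<delta> by (simp add: w_def t_def dist_norm)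
    qed
    have "w (k n) \<in> cball xs \<delta> \<times> cball ys \<delta>" for n
      using w_dist[of n] dist_fst_le[of "w (k n)" ?s] dist_snd_le[of "w (k n)" ?s]
      by (auto simp: mem_Times_iff dist_commute)
    moreover have "compact (cball xs \<delta> \<times> cball ys \<delta>)"
      using fin_dim_E1 fin_dim_E2 by (intro compact_Times compact_cball_finite_span)
    ultimately obtain l j where j: "strict_mono (j :: nat \<Rightarrow> nat)"
      and lim: "((\<lambda>n. w (k n)) \<circ> j) \<longlonglongrightarrow> l"
      unfolding compact_def by metis
    obtain xl yl where l: "l = (xl, yl)"
      by fastforce
    define m where "m = k \<circ> j"
    have m: "strict_mono m"
      using k j by (simp add: m_def strict_mono_o)
    have wm: "(\<lambda>n. w (m n)) \<longlonglongrightarrow> (xl, yl)"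
      using lim by (simp add: m_def o_def l)
    have x_lim: "(\<lambda>n. xs + t (m n) *\<^sub>R (fst (z (m n)) - xs)) \<longlonglongrightarrow> xl"
      using tendsto_fst[OF wm] by (simp add: w_def)
    have y_lim: "(\<lambda>n. ys + t (m n) *\<^sub>R (snd (z (m n)) - ys)) \<longlonglongrightarrow> yl"
      using tendsto_snd[OF wm] by (simp add: w_def)
    have t: "0 \<le> t (m n)" "t (m n) \<le> 1" for n
    proof -
      have "\<delta> \<le> dist (z (m n)) ?s"
        using far by (simp add: m_def)
      then show "0 \<le> t (m n)" "t (m n) \<le> 1"
        unfolding t_def using \<delta> by (auto simp: divide_le_eq_1)
    qed
    obtain \<epsilon> where \<epsilon>: "\<And>n. \<epsilon> n > 0" "\<epsilon> \<longlonglongrightarrow> 0"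
      and near: "\<And>n. infdist (fst (z n)) C \<le> \<epsilon> n" "\<And>n. infdist (snd (z n)) Q \<le> \<epsilon> n"
      and lin: "\<And>n. norm (snd (z n) - A (fst (z n))) \<le> \<epsilon> n"
      and approx: "\<And>n x. x \<in> C \<Longrightarrow> ft (p n) (fst (z n)) x \<ge> - \<epsilon> n"
        "\<And>n y. y \<in> Q \<Longrightarrow> gt (p n) (snd (z n)) y \<ge> - \<epsilon> n"
      using z unfolding gen_approximating_seq_def by blast
    have pm: "(\<lambda>n. p (m n)) \<longlonglongrightarrow> pstar" and \<epsilon>m: "(\<lambda>n. \<epsilon> (m n)) \<longlonglongrightarrow> 0"
      using LIMSEQ_subseq_LIMSEQ[OF p m] LIMSEQ_subseq_LIMSEQ[OF \<epsilon>(2) m] by (simp_all add: o_def)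
    have xl: "xl \<in> C" "ft pstar xl x \<ge> 0" if "x \<in> C" for x
      by (rule limit_of_rescaled_is_equilibrium[where h = ft and C = C and M = M and s = xs
            and p = "\<lambda>n. p (m n)" and t = "\<lambda>n. t (m n)" and \<epsilon> = "\<lambda>n. \<epsilon> (m n)"
            and x = "\<lambda>n. fst (z (m n))"]; fact)+
    have yl: "yl \<in> Q" "gt pstar yl y \<ge> 0" if "y \<in> Q" for y
      by (rule limit_of_rescaled_is_equilibrium[where h = gt and C = Q and M = M and s = ys
            and p = "\<lambda>n. p (m n)" and t = "\<lambda>n. t (m n)" and \<epsilon> = "\<lambda>n. \<epsilon> (m n)"
            and x = "\<lambda>n. snd (z (m n))"]; fact)+
    have "yl = A xl"
    proof -
      \<comment> \<open>Since \<open>ys = A xs\<close>, the defect of the rescaled pair is exactly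
        \<open>t (m n)\<close> times the defect of \<open>z (m n)\<close>. It tends to 0 and also to
        \<open>yl - A xl\<close>.\<close>
      have "(\<lambda>n. t (m n) *\<^sub>R (snd (z (m n)) - A (fst (z (m n))))) \<longlonglongrightarrow> 0"
      proof (rule Lim_null_comparison[OF _ \<epsilon>m])
        have "norm (t (m n) *\<^sub>R (snd (z (m n)) - A (fst (z (m n))))) \<le> \<epsilon> (m n)" for n
          using mult_mono[OF t(2)[of n] lin[of "m n"]] t(1)[of n] by simp
        then show "\<forall>\<^sub>F n in sequentially.
            norm (t (m n) *\<^sub>R (snd (z (m n)) - A (fst (z (m n))))) \<le> \<epsilon> (m n)"
          by simp
      qed
      moreover have "(\<lambda>n. t (m n) *\<^sub>R (snd (z (m n)) - A (fst (z (m n))))) \<longlonglongrightarrow> yl - A xl"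
        using tendsto_diff[OF y_lim A.tendsto[OF x_lim]]
        by (simp add: ys_eq A.add A.diff A.scaleR algebra_simps)
      ultimately show ?thesis
        using LIMSEQ_unique by fastforce
    qed
    \<comment> \<open>The memberships in \<open>xl\<close> and \<open>yl\<close> were also proved
      under the premises \<open>x \<in> C\<close> and \<open>y \<in> Q\<close>; \<open>xs\<close>
      and \<open>ys\<close> are the points that discharge them.\<close>
    with xl yl xs(1) ys(1) have "(xl, yl) \<in> SEP_solutions f g C Q A"
      by (auto simp: SEP_solutions_def ft_pstar gt_pstar)
    with S have "(xl, yl) = ?s"
      by blast
    moreover have "(\<lambda>n. dist (w (m n)) ?s) \<longlonglongrightarrow> dist (xl, yl) ?s"
      by (intro tendsto_dist wm tendsto_const)
    then have "dist (xl, yl) ?s = \<delta>"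
      using w_dist by (simp add: m_def LIMSEQ_const_iff)
    ultimately show False
      using \<delta> by simp
  qed
  then show "LP_well_posed_by_perturbations f g C Q A M pstar ft gt"
    unfolding LP_well_posed_by_perturbations_def using S by blast
qed

end
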